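(* The outcome of the complete thermodynamical description of the Stern--Brocot system (the results (1) and (2) recalled in the context, concerning the pressure function $P$, the multifractal spectrum $\tau$, the relation between them, and the phase transition at $t=1$) stays the same if the analysis is based exclusively on either $\{I\in\mathcal{C}_n:n\in\mathbb{N}\}$ or $\{I\in\mathcal{C}_n^c:n\in\mathbb{N}\}$, rather than on all the intervals in $\{I\in\mathcal{T}_n:n\in\mathbb{N}\}$. In particular, $$P(t)=P_0(t)=P_1(t)\qquad\text{for all }t\in\mathbb{R}.$$
   Context: Stern--Brocot sequence: for $n\in\mathbb{N}_0$ the integers $s_{n,k},t_{n,k}$ ($k=1,\ldots,2^n+1$) are defined by $s_{0,1}:=0$, $s_{0,2}:=t_{0,1}:=t_{0,2}:=1$; $s_{n+1,2k-1}:=s_{n,k}$ and $t_{n+1,2k-1}:=t_{n,k}$ for $k=1,\ldots,2^n+1$; $s_{n+1,2k}:=s_{n,k}+s_{n,k+1}$ and $t_{n+1,2k}:=t_{n,k}+t_{n,k+1}$ for $k=1,\ldots,2^n$. The set of Stern--Brocot intervals of order $n$ is $$\mathcal{T}_n:=\Big\{\Big[\tfrac{s_{n,k}}{t_{n,k}},\tfrac{s_{n,k+1}}{t_{n,k+1}}\Big]:k=1,\ldots,2^n\Big\}.$$ The sum-level set of order $n\in\mathbb{N}$ is $\mathcal{C}_n:=\{[a_1,a_2,\ldots]\in[0,1]:\sum_{i=1}^k a_i=n\text{ for some }k\in\mathbb{N}\}$, where $[a_1,a_2,\ldots]$ denotes the regular continued fraction with positive integer entries $a_i$. In terms of Stern--Brocot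 intervals it is given by $\mathcal{C}_1=[s_{1,2}/t_{1,2},s_{1,3}/t_{1,3}]$ and, for $n\ge2$, $$\mathcal{C}_n=\bigcup_{k=1}^{2^{n-2}}\Big[\tfrac{s_{n,4k-2}}{t_{n,4k-2}},\tfrac{s_{n,4k}}{t_{n,4k}}\Big].$$ For $I\in\mathcal{T}_n$ one writes $I\in\mathcal{C}_n$ if $I\subset\mathcal{C}_n$; $\mathcal{C}_n^c$ denotes the set of all intervals in $\mathcal{T}_n$ that are not in $\mathcal{C}_n$. Pressure functions: for $t\in\mathbb{R}$, the Stern--Brocot pressure function is $$P(t):=\lim_{n\to\infty}\frac1n\log\sum_{I\in\mathcal{T}_n}(\operatorname{diam}(I))^t,$$ and the two partial Stern--Brocot pressure functions are $$P_0(t):=\lim_{n\to\infty}\frac1n\log\sum_{I\in\mathcal{C}_n}(\operatorname{diam}(I))^t,\qquad P_1(t):=\lim_{n\to\infty}\frac1n\log\sum_{I\in\mathcal{C}_n^c}(\operatorname{diam}(I))^t.$$ Multifractal spectrum: for $s\in\mathbb{R}$, $$\tau(s):=\dim_H\Big(\Big\{x=[a_1,a_2,\ldots]:\lim_{n\to\infty}\frac{2\log q_n(x)}{\sum_{i=1}^n a_i}=s\Big\}\Big),$$ where $p_n(x)/q_n(x):=[a_1,\ldots,a_n]$ is the $n$-th approximant of $x$ and $\dim_H$ is Hausdorff dimension. Let $\gamma:=(1+\sqrt5)/2$ and let $P^*(s):=\sup_{t\in\mathbb{R}}\{ts-P(t)\}$ be the Legendre transform of $P$. The complete thermodynamical description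 of the Stern--Brocot system referred to in the claim consists of the following previously known results, as recalled in the paper. (1) For each $s\in[0,2\log\gamma]$ one has $\tau(s)=-P^*(-s)/s$, with the convention $\tau(0):=\lim_{s\searrow0}-P^*(-s)/s=1$. The dimension function $\tau$ is continuous and strictly decreasing on $[0,2\log\gamma]$, vanishes outside the interval $[0,2\log\gamma)$, and its left derivative at $2\log\gamma$ equals $-\infty$. The function $P$ is convex, non-increasing and differentiable throughout $\mathbb{R}$; it is real-analytic on $(-\infty,1)$ and vanishes on $[1,\infty)$. (2) $P(1-\epsilon)\sim-\epsilon/\log\epsilon$ for $\epsilon$ tending to zero from above (where $\sim$ means that the quotient of the two sides tends to $1$). In particular, the Farey system has a second order phase transition at $t=1$, that is, $P'$ is continuous and $P''$ is discontinuous at $t=1$. *)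

theory Defs
  imports "HOL-Analysis.Analysis" "HOL-Library.Landau_Symbols"
begin

text \<open>The Stern--Brocot integers \<open>s\<^sub>n\<^sub>,\<^sub>k\<close> and \<open>t\<^sub>n\<^sub>,\<^sub>k\<close>, meaningful for
  \<open>1 \<le> k \<le> 2 ^ n + 1\<close> only; values outside this range are junk and are never used.\<close>

fun sb_s :: "nat \<Rightarrow> nat \<Rightarrow> nat" where
  "sb_s 0 k = (if k = 1 then 0 else 1)"
| "sb_s (Suc n) k =
     (if odd k then sb_s n ((k + 1) div 2) else sb_s n (k div 2) + sb_s n (k div 2 + 1))"

fun sb_t :: "nat \<Rightarrow> nat \<Rightarrow> nat" where
  "sb_t 0 k = 1"
| "sb_t (Suc n) k =
     (if odd k then sb_t n ((k + 1) div 2) else sb_t n (k div 2) + sb_t n (k div 2 + 1))"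

definition sb_intervals :: "nat \<Rightarrow> real set set" where
  "sb_intervals n =
     {{real (sb_s n k) / real (sb_t n k) .. real (sb_s n (k + 1)) / real (sb_t n (k + 1))}
      | k. k \<in> {1..2 ^ n}}"

text \<open>The finite continued fraction \<open>[a\<^sub>1, \<dots>, a\<^sub>n] = 1 / (a\<^sub>1 + 1 / (a\<^sub>2 + \<dots>))\<close>.\<close>

fun cfrac :: "nat list \<Rightarrow> rat" where
  "cfrac [] = 0"
| "cfrac (a # as) = 1 / (of_nat a + cfrac as)"

text \<open>Infinite sequences of partial quotients are indexed from 1; the value \<open>a 0\<close> is irrelevant.\<close>

definition approximant :: "(nat \<Rightarrow> nat) \<Rightarrow> nat \<Rightarrow> rat" where
  "approximant a n = cfrac (map a [1..<Suc n])"

definition approximant_denom :: "(nat \<Rightarrow> nat) \<Rightarrow> nat \<Rightarrow> int" where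
  "approximant_denom a n = snd (quotient_of (approximant a n))"

definition is_cfrac :: "(nat \<Rightarrow> nat) \<Rightarrow> real \<Rightarrow> bool" where
  "is_cfrac a x \<longleftrightarrow>
     (\<forall>i\<ge>1. a i \<ge> 1) \<and> (\<lambda>n. real_of_rat (approximant a n)) \<longlonglongrightarrow> x"

text \<open>Sum-level sets. Rational points take part through their finite expansions, and both finite
  expansions \<open>[a\<^sub>1, \<dots>, a\<^sub>m + 1] = [a\<^sub>1, \<dots>, a\<^sub>m, 1]\<close> are admitted. This makes the set the union of the
  closed cylinders of level \<open>n\<close>; with irrational points only, it would not contain any
  Stern--Brocot interval.\<close>

definition sum_level_set :: "nat \<Rightarrow> real set" where
  "sum_level_set n = {x \<in> {0..1}.
     (\<exists>a. is_cfrac a x \<and> (\<exists>k\<ge>1. (\<Sum>i=1..k. a i) = n)) \<or>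
     (\<exists>as. (\<forall>a\<in>set as. a \<ge> 1) \<and> x = real_of_rat (cfrac as) \<and>
        (\<exists>k\<in>{1..length as}. sum_list (take k as) = n))}"

definition level_intervals :: "nat \<Rightarrow> real set set" where
  "level_intervals n = {I \<in> sb_intervals n. I \<subseteq> sum_level_set n}"

definition colevel_intervals :: "nat \<Rightarrow> real set set" where
  "colevel_intervals n = sb_intervals n - level_intervals n"

text \<open>The pressure function of an arbitrary sequence of families of intervals. Here \<open>P\<close>, \<open>P\<^sub>0\<close> and
  \<open>P\<^sub>1\<close> are the cases of \<^const>\<open>sb_intervals\<close>, \<^const>\<open>level_intervals\<close> and
  \<^const>\<open>colevel_intervals\<close>.\<close>

definition log_partition :: "(nat \<Rightarrow> real set set) \<Rightarrow> real \<Rightarrow> nat \<Rightarrow> real" where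
  "log_partition F t n = 1 / real n * ln (\<Sum>I\<in>F n. diameter I powr t)"

definition pressure :: "(nat \<Rightarrow> real set set) \<Rightarrow> real \<Rightarrow> real" where
  "pressure F t = lim (log_partition F t)"

text \<open>Hausdorff measure and dimension. Boundedness of the covering sets is required because
  \<^const>\<open>diameter\<close> is unspecified on unbounded sets. Taking only exponents \<open>d > 0\<close> in the
  infimum avoids the expression \<open>0\<^sup>0\<close>; the infimum is over a nonempty set since
  \<open>\<H>\<^sup>d(A) = 0\<close> for every real \<open>d > 1\<close> and every set \<open>A\<close> of reals. The empty set has dimension 0.\<close>

definition hausdorff_premeasure :: "real \<Rightarrow> real \<Rightarrow> real set \<Rightarrow> ennreal" where
  "hausdorff_premeasure d \<delta> A =
     (INF U \<in> {U :: nat \<Rightarrow> real set. A \<subseteq> (\<Union>i. U i) \<and> (\<forall>i. bounded (U i) \<and> diameter (U i) \<le> \<delta>)}.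
        \<Sum>i. ennreal (diameter (U i) powr d))"

definition hausdorff_measure :: "real \<Rightarrow> real set \<Rightarrow> ennreal" where
  "hausdorff_measure d A = (SUP \<delta>\<in>{0<..}. hausdorff_premeasure d \<delta> A)"

definition hausdorff_dim :: "real set \<Rightarrow> real" where
  "hausdorff_dim A = Inf {d. d > 0 \<and> hausdorff_measure d A = 0}"

definition multifractal_spectrum :: "real \<Rightarrow> real" where
  "multifractal_spectrum s = hausdorff_dim {x. \<exists>a. is_cfrac a x \<and>
     (\<lambda>n. 2 * ln (real_of_int (approximant_denom a n)) / real (\<Sum>i=1..n. a i)) \<longlonglongrightarrow> s}"

definition golden_ratio :: real where
  "golden_ratio = (1 + sqrt 5) / 2"

definition legendre :: "(real \<Rightarrow> real) \<Rightarrow> real \<Rightarrow> ereal" where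
  "legendre P s = (SUP t. ereal (t * s - P t))"

definition real_analytic_on :: "(real \<Rightarrow> real) \<Rightarrow> real set \<Rightarrow> bool" where
  "real_analytic_on f S \<longleftrightarrow> (\<forall>x\<in>S. \<exists>F. (\<lambda>h. f (x + h)) has_fps_expansion F)"

text \<open>The two parts of the thermodynamical description, for the analysis based on the intervals in
  the families \<open>F n\<close>. The spectrum is defined through continued fractions and does not depend on
  the family; the family enters through its pressure function.\<close>

definition multifractal_formalism :: "(nat \<Rightarrow> real set set) \<Rightarrow> bool" where
  "multifractal_formalism F \<longleftrightarrow>
     (let P = pressure F; \<tau> = multifractal_spectrum; s\<^sub>m\<^sub>a\<^sub>x = 2 * ln golden_ratio in
       (\<forall>s\<in>{0<..s\<^sub>m\<^sub>a\<^sub>x}. ereal (\<tau> s) = - legendre P (- s) / ereal s) \<and>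
       ((\<lambda>s. - legendre P (- s) / ereal s) \<longlongrightarrow> 1) (at_right 0) \<and> \<tau> 0 = 1 \<and>
       continuous_on {0..s\<^sub>m\<^sub>a\<^sub>x} \<tau> \<and>
       strict_antimono_on {0..s\<^sub>m\<^sub>a\<^sub>x} \<tau> \<and>
       (\<forall>s. s \<notin> {0..<s\<^sub>m\<^sub>a\<^sub>x} \<longrightarrow> \<tau> s = 0) \<and>
       filterlim (\<lambda>s. (\<tau> s - \<tau> s\<^sub>m\<^sub>a\<^sub>x) / (s - s\<^sub>m\<^sub>a\<^sub>x)) at_bot (at_left s\<^sub>m\<^sub>a\<^sub>x) \<and>
       convex_on UNIV P \<and> antimono P \<and> (\<forall>t. P differentiable (at t)) \<and>
       real_analytic_on P {..<1} \<and> (\<forall>t\<ge>1. P t = 0))"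

text \<open>The second derivative need not exist at 1 itself, so its discontinuity there is expressed as
  the absence of any finite limit at 1; this does not depend on the value that \<^const>\<open>deriv\<close>
  assigns at a point of non-differentiability.\<close>

definition second_order_phase_transition :: "(nat \<Rightarrow> real set set) \<Rightarrow> bool" where
  "second_order_phase_transition F \<longleftrightarrow>
     (let P = pressure F in
       (\<lambda>\<epsilon>. P (1 - \<epsilon>)) \<sim>[at_right 0] (\<lambda>\<epsilon>. - \<epsilon> / ln \<epsilon>) \<and>
       isCont (deriv P) 1 \<and>
       \<not> (\<exists>l. (deriv (deriv P) \<longlongrightarrow> l) (at 1)))"

end

theory Submission
  imports Defs "HOL-Real_Asymp.Real_Asymp"
begin

text \<open>A Stern--Brocot interval of order \<open>n \<ge> 1\<close> is split at its mediant into two intervals of order \<open>n + 1\<close>,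
  called its halves, and exactly one of them lies in the sum-level set of order \<open>n + 1\<close>. So passing from all intervals to the level
  intervals, or to the others, amounts to choosing one half of every interval of the preceding order.
  Choosing halves does not affect exponential growth rates: the ratio of neighbouring denominators in
  order \<open>n\<close> is at most \<open>n + 1\<close>, hence an interval and its halves have comparable diameters up to a
  factor polynomial in \<open>n\<close>. The partial sums are thus squeezed between the full sums of orders \<open>n\<close> and
  \<open>n + 1\<close>, up to such factors (\<open>partition_upper\<close>, \<open>partition_lower\<close>), and the three pressures agree. The
  thermodynamical description depends on the family of intervals only through its pressure function,
  so it carries over.

  That the limits exist at all comes from Fekete's lemma. The diameter \<open>1 / (a b)\<close> of an interval with end
  point denominators \<open>a\<close> and \<open>b\<close> is replaced by \<open>1 / (a + b)\<^sup>2\<close>, again at the cost of a polynomial factor.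
  The sums \<open>a + b\<close> are exactly submultiplicative under refinement (\<open>den_sum_submultiplicative\<close>), so the
  modified partition sums are submultiplicative for \<open>t \<le> 0\<close> and supermultiplicative for \<open>t \<ge> 0\<close>.

  The halves that lie in the sum-level set are found with the Farey map. Its inverse branches
  \<open>y \<mapsto> y / (1 + y)\<close> and \<open>y \<mapsto> 1 / (1 + y)\<close> increase the first continued fraction digit and prepend the
  digit 1, so the two images of the sum-level set of order \<open>n \<ge> 1\<close> make up that of order \<open>n + 1\<close>
  (\<open>sum_level_set_Suc\<close>), just as the images of the intervals of order \<open>n\<close> are those of order \<open>n + 1\<close>. By induction, an interval
  belongs to the level exactly if its index, counted from 0, is 1 or 2 modulo 4
  (\<open>sb_interval_level_iff\<close>). This induction starts at \<open>\<C>\<^sub>1 = [1 / 2, 1]\<close>, which rests on the existence of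
  a continued fraction expansion for every number in \<open>[0, 1]\<close>.\<close>

section \<open>Subadditive sequences\<close>

lemma subadditive_mult:
  fixes u :: "nat \<Rightarrow> real"
  assumes "\<And>m n. u (m + n) \<le> u m + u n"
  shows "u (q * m + r) \<le> q * u m + u r"
proof (induction q)
  case (Suc q)
  have "u (Suc q * m + r) \<le> u m + u (q * m + r)"
    using assms[of m "q * m + r"] by (simp add: add.assoc)
  with Suc show ?case by (simp add: algebra_simps)
qed simp

text \<open>Fekete's lemma: writing \<open>n = q m + r\<close> gives \<open>u n / n \<le> u m / m + O(1 / n)\<close> for
  every fixed \<open>m\<close>, so the quotients converge to their infimum. The linear lower bound makes that
  infimum finite.\<close>

lemma fekete:
  fixes u :: "nat \<Rightarrow> real"
  assumes sub: "\<And>m n. u (m + n) \<le> u m + u n" and low: "\<And>n. - C * real n \<le> u n"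
  shows "convergent (\<lambda>n. u n / real n)"
proof -
  define L where "L = (INF n\<in>{1..}. u n / real n)"
  have bdd: "bdd_below ((\<lambda>n. u n / real n) ` {1..})"
  proof (rule bdd_belowI2)
    fix n :: nat assume "n \<in> {1..}"
    then show "- C \<le> u n / real n" using low[of n] by (simp add: field_simps)
  qed
  have lower: "L \<le> u n / real n" if "n \<ge> 1" for n
    unfolding L_def using bdd that by (intro cINF_lower) auto
  have "(\<lambda>n. u n / real n) \<longlonglongrightarrow> L"
  proof (rule order_tendstoI)
    fix y assume "y < L"
    then show "\<forall>\<^sub>F n in sequentially. y < u n / real n"
      using lower by (intro eventually_sequentiallyI[of 1]) force
  next
    fix y assume "L < y"
    then obtain m where m: "m \<ge> 1" "u m / real m < y"
      unfolding L_def by (subst (asm) cINF_less_iff[OF _ bdd]) auto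
    \<comment> \<open>The remainder of the division by \<open>m\<close> changes the numerator by at most \<open>B\<close>.\<close>
    define B where "B = \<bar>u m\<bar> + (\<Sum>r<m. \<bar>u r\<bar>)"
    have upper: "u n / real n \<le> u m / real m + B / real n" if "n \<ge> 1" for n
    proof -
      let ?q = "n div m" and ?r = "n mod m"
      have r: "?r < m" using m by simp
      have n: "real ?q * real m = real n - real ?r"
        by (metis div_mult_mod_eq add_diff_cancel_right' of_nat_add of_nat_mult)
      have "real ?q = (real n - real ?r) / m" using n m by (simp add: field_simps)
      then have "?q * u m = n * (u m / m) - real ?r / m * u m"
        by (simp only: diff_divide_distrib left_diff_distrib) simp
      moreover have "\<bar>real ?r / m * u m\<bar> \<le> 1 * \<bar>u m\<bar>"
        unfolding abs_mult using r by (intro mult_right_mono) auto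
      moreover have "u ?r \<le> (\<Sum>r<m. \<bar>u r\<bar>)"
        using member_le_sum[of ?r "{..<m}" "\<lambda>r. \<bar>u r\<bar>"] r by auto
      moreover have "u n \<le> ?q * u m + u ?r"
        using subadditive_mult[OF sub, of ?q m ?r] by simp
      ultimately have "u n \<le> n * (u m / m) + B" unfolding B_def by linarith
      then show ?thesis using that by (simp add: field_simps)
    qed
    have "(\<lambda>n. u m / real m + B / real n) \<longlonglongrightarrow> u m / real m" by real_asymp
    then have "\<forall>\<^sub>F n in sequentially. u m / real m + B / real n < y"
      using m by (auto dest: order_tendstoD)
    then show "\<forall>\<^sub>F n in sequentially. u n / real n < y"
      using eventually_ge_at_top[of 1] by eventually_elim (use upper in force)
  qed
  then show ?thesis by (auto simp: convergent_def)
qed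

section \<open>Submultiplicativity of Stern--Brocot denominators\<close>

lemma sb_t_pos: "0 < sb_t n k"
  by (induction n arbitrary: k) (auto simp: add_pos_pos)

text \<open>One refinement step replaces a ratio \<open>a / b\<close> of neighbouring denominators by \<open>a / (a + b)\<close> and
  \<open>(a + b) / b = a / b + 1\<close>, so that after \<open>n\<close> steps ratios are at most \<open>n + 1\<close>. This is the reason
  why all distortions below are polynomial in \<open>n\<close>.\<close>

lemma sb_t_neighbours:
  "sb_t n k \<le> (n + 1) * sb_t n (k + 1) \<and> sb_t n (k + 1) \<le> (n + 1) * sb_t n k"
proof (induction n arbitrary: k)
  case (Suc n)
  show ?case
  proof (cases "odd k")
    case True
    then obtain j where k: "k = 2 * j + 1" by (auto elim: oddE)
    show ?thesis using Suc.IH[of "j + 1"] by (simp add: k)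
  next
    case False
    then obtain j where k: "k = 2 * j" by (auto elim: evenE)
    show ?thesis using Suc.IH[of j] by (simp add: k)
  qed
qed simp

lemma sb_determinant:
  "k < 2 ^ n \<Longrightarrow>
     sb_s n (k + 2) * sb_t n (k + 1) = sb_s n (k + 1) * sb_t n (k + 2) + 1"
proof (induction n arbitrary: k)
  case (Suc n)
  show ?case
  proof (cases "odd k")
    case True
    then obtain j where k: "k = 2 * j + 1" by (auto elim: oddE)
    show ?thesis using Suc.IH[of j] Suc.prems by (simp add: k algebra_simps)
  next
    case False
    then obtain j where k: "k = 2 * j" by (auto elim: evenE)
    show ?thesis using Suc.IH[of j] Suc.prems by (simp add: k algebra_simps)
  qed
qed simp

text \<open>The \<open>m\<close>-fold refinement of the interval number \<open>j\<close> of order \<open>n\<close> obeys the same linear recursion as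
  the \<open>m\<close>-fold refinement of the unit interval. Both initial denominators of the former are bounded by
  their sum, while those of the latter are 1; linearity propagates this bound.\<close>

lemma sb_t_submultiplicative:
  "1 \<le> i \<Longrightarrow> i \<le> 2 ^ m + 1 \<Longrightarrow>
     sb_t (n + m) (2 ^ m * j + i) \<le> (sb_t n (j + 1) + sb_t n (j + 2)) * sb_t m i"
proof (induction m arbitrary: i)
  case 0
  then have "i = 1 \<or> i = 2" by auto
  then show ?case by auto
next
  case (Suc m)
  show ?case
  proof (cases "odd i")
    case True
    then obtain l where i: "i = 2 * l + 1" by (auto elim: oddE)
    have "2 ^ Suc m * j + i = 2 * (2 ^ m * j + l) + 1" by (simp add: i)
    then show ?thesis using Suc.IH[of "l + 1"] Suc.prems by (simp add: i)
  next
    case False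
    then obtain l where i: "i = 2 * l" by (auto elim: evenE)
    have "2 ^ Suc m * j + i = 2 * (2 ^ m * j + l)" by (simp add: i)
    then show ?thesis using Suc.IH[of l] Suc.IH[of "l + 1"] Suc.prems
      by (simp add: i algebra_simps)
  qed
qed

text \<open>The sum of the two end point denominators of an interval, that is, the entry sum of the nonnegative
  integer matrix attached to the interval. Entry sums of such matrices are submultiplicative without
  any constant, which diameters are not; this is why they replace the diameters.\<close>

definition den_sum :: "nat \<Rightarrow> nat \<Rightarrow> nat" where
  "den_sum n k = sb_t n (k + 1) + sb_t n (k + 2)"

lemma den_sum_ge_1: "1 \<le> den_sum n k"
  using sb_t_pos[of n "k + 1"] by (simp add: den_sum_def)

lemma den_sum_submultiplicative:
  assumes "i < 2 ^ m"
  shows "den_sum (n + m) (j * 2 ^ m + i) \<le> den_sum n j * den_sum m i"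
  using sb_t_submultiplicative[of "i + 1" m n j] sb_t_submultiplicative[of "i + 2" m n j] assms
  by (simp add: den_sum_def algebra_simps)

definition den_partition :: "real \<Rightarrow> nat \<Rightarrow> real" where
  "den_partition t n = (\<Sum>k<2 ^ n. real (den_sum n k) powr (- 2 * t))"

lemma den_partition_pos: "0 < den_partition t n"
  unfolding den_partition_def
  by (intro sum_pos) (use den_sum_ge_1 in \<open>auto simp: lessThan_empty_iff Suc_le_eq\<close>)

lemma den_partition_blocks:
  "den_partition t (n + m) =
     (\<Sum>j<2 ^ n. \<Sum>i<2 ^ m. real (den_sum (n + m) (j * 2 ^ m + i)) powr (- 2 * t))"
proof -
  have "(\<Sum>i\<in>{j * 2 ^ m..<j * 2 ^ m + 2 ^ m}. g i) = (\<Sum>i<2 ^ m. g (j * 2 ^ m + i))"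
    for j and g :: "nat \<Rightarrow> real"
    using sum.shift_bounds_nat_ivl[of g 0 "j * 2 ^ m" "2 ^ m"]
    by (simp add: add.commute atLeast0LessThan)
  then show ?thesis
    unfolding den_partition_def power_add
    by (subst sum.nat_group[symmetric]) simp
qed

lemma den_partition_product:
  "den_partition t n * den_partition t m =
     (\<Sum>j<2 ^ n. \<Sum>i<2 ^ m. (real (den_sum n j) * real (den_sum m i)) powr (- 2 * t))"
  unfolding den_partition_def sum_product by (simp add: powr_mult)

lemma den_partition_submultiplicative:
  assumes "t \<le> 0"
  shows "den_partition t (n + m) \<le> den_partition t n * den_partition t m"
  unfolding den_partition_blocks den_partition_product
proof (intro sum_mono powr_mono2)
  fix i j assume "i \<in> {..<2 ^ m :: nat}"
  then show "real (den_sum (n + m) (j * 2 ^ m + i)) \<le> real (den_sum n j) * real (den_sum m i)"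
    using den_sum_submultiplicative[of i m n j] by (simp flip: of_nat_mult)
qed (use assms in auto)

lemma den_partition_supermultiplicative:
  assumes "0 \<le> t"
  shows "den_partition t n * den_partition t m \<le> den_partition t (n + m)"
  unfolding den_partition_blocks den_partition_product
proof (intro sum_mono powr_mono2')
  fix i j assume "i \<in> {..<2 ^ m :: nat}"
  then show "real (den_sum (n + m) (j * 2 ^ m + i)) \<le> real (den_sum n j) * real (den_sum m i)"
    using den_sum_submultiplicative[of i m n j] by (simp flip: of_nat_mult)
qed (use assms den_sum_ge_1 in \<open>auto simp: Suc_le_eq\<close>)

text \<open>The sign of \<open>t\<close> decides whether the partition sums are sub- or supermultiplicative; their logarithms
  then satisfy the hypotheses of Fekete's lemma up to sign. For the linear bound,
  the first summand is at least 1 if \<open>t \<le> 0\<close>, and each of the \<open>2 ^ n\<close> summands is at most 1 if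
  \<open>t > 0\<close>.\<close>

lemma den_partition_rate_convergent: "convergent (\<lambda>n. ln (den_partition t n) / real n)"
proof (cases "t \<le> 0")
  case True
  show ?thesis
  proof (rule fekete)
    fix m n
    show "ln (den_partition t (m + n)) \<le> ln (den_partition t m) + ln (den_partition t n)"
      using den_partition_submultiplicative[OF True, of m n]
      by (simp add: den_partition_pos flip: ln_mult_pos)
    have "1 powr (- 2 * t) \<le> real (den_sum n 0) powr (- 2 * t)"
      using True den_sum_ge_1[of n 0] by (intro powr_mono2) auto
    also have "\<dots> \<le> den_partition t n"
      unfolding den_partition_def
      by (rule member_le_sum[of 0 _ "\<lambda>k. real (den_sum n k) powr (- 2 * t)"]) auto
    finally show "- 0 * real n \<le> ln (den_partition t n)" by simp
  qed
next
  case False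
  have "convergent (\<lambda>n. - ln (den_partition t n) / real n)"
  proof (rule fekete)
    fix m n
    show "- ln (den_partition t (m + n)) \<le> - ln (den_partition t m) + - ln (den_partition t n)"
      using ln_mono[OF den_partition_supermultiplicative[of t m n]] False
      by (simp add: den_partition_pos ln_mult_pos)
    have "den_partition t n \<le> (\<Sum>k<2 ^ n :: nat. 1)"
      unfolding den_partition_def
    proof (intro sum_mono)
      fix k
      have "real (den_sum n k) powr (- 2 * t) \<le> 1 powr (- 2 * t)"
        using False den_sum_ge_1[of n k] by (intro powr_mono2') auto
      then show "real (den_sum n k) powr (- 2 * t) \<le> 1" by simp
    qed
    then have "ln (den_partition t n) \<le> ln (2 ^ n)"
      by (simp add: den_partition_pos)
    then show "- ln 2 * real n \<le> - ln (den_partition t n)"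
      by (simp add: ln_realpow mult.commute)
  qed
  then show ?thesis
    by (subst (asm) convergent_minus_iff) simp
qed

section \<open>Existence of continued fraction expansions\<close>

text \<open>A finite continued fraction with a remainder \<open>z\<close> in \<open>[0, 1]\<close> added to its last digit; the remainder
  0 gives the rational value of the digits.\<close>

fun cf_eval :: "nat list \<Rightarrow> real \<Rightarrow> real" where
  "cf_eval [] z = z"
| "cf_eval (a # as) z = 1 / (real a + cf_eval as z)"

lemma cf_eval_0: "cf_eval as 0 = real_of_rat (cfrac as)"
  by (induction as) (auto simp: of_rat_divide of_rat_add)

lemma cf_eval_snoc: "cf_eval (as @ [a]) z = cf_eval as (1 / (real a + z))"
  by (induction as) auto

lemma cf_eval_unit_interval:
  "\<forall>a\<in>set as. a \<ge> 1 \<Longrightarrow> z \<in> {0..1} \<Longrightarrow> cf_eval as z \<in> {0..1}"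
  by (induction as) (auto simp: divide_simps)

text \<open>A single digit 1 has derivative \<open>-1\<close> at 0 and does not contract, but two successive digits contract
  by the factor 4, as \<open>a (b + p) + 1 \<ge> 2\<close>.\<close>

lemma two_digits_contract:
  fixes a b p q :: real
  assumes "a \<ge> 1" "b \<ge> 1" "p \<ge> 0" "q \<ge> 0"
  shows "\<bar>1 / (a + 1 / (b + p)) - 1 / (a + 1 / (b + q))\<bar> \<le> \<bar>p - q\<bar> / 4"
proof -
  have ge: "2 \<le> a * (b + r) + 1" if "r \<ge> 0" for r
    using mult_mono[of 1 a 1 "b + r"] assms that by simp
  have eq: "1 / (a + 1 / (b + r)) = (b + r) / (a * (b + r) + 1)" if "r \<ge> 0" for r
    using assms that by (simp add: field_simps)
  define D where "D = (a * (b + p) + 1) * (a * (b + q) + 1)"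
  have "1 / (a + 1 / (b + p)) - 1 / (a + 1 / (b + q)) = (p - q) / D"
    unfolding eq[OF assms(3)] eq[OF assms(4)] D_def
    using ge[OF assms(3)] ge[OF assms(4)] by (simp add: divide_simps) (simp add: algebra_simps)
  moreover have "2 * 2 \<le> D"
    unfolding D_def by (intro mult_mono ge assms) (use ge[OF assms(3)] in auto)
  ultimately show ?thesis
    using frac_le[of "\<bar>p - q\<bar>" "\<bar>p - q\<bar>" 4 D] by (simp add: abs_divide)
qed

lemma cf_eval_contracts:
  assumes "\<forall>a\<in>set as. a \<ge> 1" "u \<in> {0..1}" "v \<in> {0..1}"
  shows "\<bar>cf_eval as u - cf_eval as v\<bar> \<le> 2 * (1 / 2) ^ length as"
  using assms(1)
proof (induction as rule: induct_list012)
  case 1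
  show ?case using assms(2,3) by auto
next
  case (2 a)
  have "cf_eval [a] u \<in> {0..1}" "cf_eval [a] v \<in> {0..1}"
    using cf_eval_unit_interval[OF 2 assms(2)] cf_eval_unit_interval[OF 2 assms(3)] by blast+
  then have "\<bar>cf_eval [a] u - cf_eval [a] v\<bar> \<le> 1"
    unfolding atLeastAtMost_iff by linarith
  then show ?case by simp
next
  case (3 a b as)
  let ?p = "cf_eval as u" and ?q = "cf_eval as v"
  have "?p \<ge> 0" "?q \<ge> 0"
    using 3 cf_eval_unit_interval[of as u] cf_eval_unit_interval[of as v] assms(2,3) by auto
  then have "\<bar>cf_eval (a # b # as) u - cf_eval (a # b # as) v\<bar> \<le> \<bar>?p - ?q\<bar> / 4"
    using 3 two_digits_contract[of "real a" "real b" ?p ?q] by simp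
  also have "\<dots> \<le> 2 * (1 / 2) ^ length (a # b # as)"
    using 3 by simp
  finally show ?case .
qed

text \<open>The orbit under the Gauss map. Since \<open>1 / 0 = 0\<close>, it stays at 0 once it gets there.\<close>

primrec gauss_orbit :: "real \<Rightarrow> nat \<Rightarrow> real" where
  "gauss_orbit x 0 = x"
| "gauss_orbit x (Suc n) = frac (1 / gauss_orbit x n)"

text \<open>Digits are numbered from 1 on, whereas the orbit starts at 0.\<close>

definition gauss_digit :: "real \<Rightarrow> nat \<Rightarrow> nat" where
  "gauss_digit x i = nat \<lfloor>1 / gauss_orbit x (i - 1)\<rfloor>"

lemma gauss_orbit_unit_interval: "x \<in> {0..1} \<Longrightarrow> gauss_orbit x n \<in> {0..1}"
  by (cases n) (auto intro: less_imp_le frac_lt_1)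

lemma gauss_digit_ge_1:
  assumes "x \<in> {0..1}" "gauss_orbit x n \<noteq> 0"
  shows "gauss_digit x (Suc n) \<ge> 1"
proof -
  have "1 \<le> 1 / gauss_orbit x n"
    using assms gauss_orbit_unit_interval[OF assms(1), of n] by simp
  then have "1 \<le> \<lfloor>1 / gauss_orbit x n\<rfloor>" by (simp add: le_floor_iff)
  then show ?thesis unfolding gauss_digit_def diff_Suc_1 by linarith
qed

lemma gauss_expansion:
  assumes "x \<in> {0..1}" "\<And>i. i < n \<Longrightarrow> gauss_orbit x i \<noteq> 0"
  shows "x = cf_eval (map (gauss_digit x) [1..<Suc n]) (gauss_orbit x n)"
  using assms(2)
proof (induction n)
  case (Suc n)
  let ?y = "gauss_orbit x n"
  have "0 \<le> \<lfloor>1 / ?y\<rfloor>"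
    using gauss_orbit_unit_interval[OF assms(1), of n] by simp
  then have "real (gauss_digit x (Suc n)) + gauss_orbit x (Suc n) = 1 / ?y"
    by (simp add: gauss_digit_def frac_def)
  then have "cf_eval (map (gauss_digit x) [1..<Suc (Suc n)]) (gauss_orbit x (Suc n)) =
               cf_eval (map (gauss_digit x) [1..<Suc n]) ?y"
    by (simp add: cf_eval_snoc del: gauss_orbit.simps)
  then show ?case using Suc by simp
qed simp

text \<open>Either the Gauss orbit reaches 0 and the digits up to then are a finite expansion, or it never does
  and contraction makes the approximants converge.\<close>

lemma continued_fraction_exists:
  assumes "x \<in> {0..1}"
  obtains (infinite) a where "is_cfrac a x"
  | (finite) as where "\<forall>a\<in>set as. a \<ge> 1" "x = real_of_rat (cfrac as)"
proof (cases "\<exists>n. gauss_orbit x n = 0")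
  case True
  define n where "n = (LEAST n. gauss_orbit x n = 0)"
  have n: "gauss_orbit x n = 0" unfolding n_def using True by (rule LeastI_ex)
  have less: "gauss_orbit x i \<noteq> 0" if "i < n" for i
    using that not_less_Least unfolding n_def by blast
  let ?as = "map (gauss_digit x) [1..<Suc n]"
  have "a \<ge> 1" if "a \<in> set ?as" for a
  proof -
    from that obtain i where i: "i \<in> {1..<Suc n}" "a = gauss_digit x i" by (auto simp del: upt_Suc)
    then show ?thesis using gauss_digit_ge_1[OF assms less, of "i - 1"] by auto
  qed
  moreover have "x = cf_eval ?as (gauss_orbit x n)"
    using less by (rule gauss_expansion[OF assms])
  then have "x = real_of_rat (cfrac ?as)" by (simp only: n cf_eval_0)
  ultimately show ?thesis using finite by blast
next
  case False
  let ?a = "gauss_digit x"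
  have a: "?a i \<ge> 1" if "i \<ge> 1" for i
    using gauss_digit_ge_1[OF assms, of "i - 1"] False that by auto
  have bound: "norm (real_of_rat (approximant ?a n) - x) \<le> 2 * (1 / 2) ^ n" for n
  proof -
    let ?as = "map ?a [1..<Suc n]"
    have "x = cf_eval ?as (gauss_orbit x n)"
      using gauss_expansion[OF assms] False by blast
    moreover have "\<bar>cf_eval ?as 0 - cf_eval ?as (gauss_orbit x n)\<bar> \<le> 2 * (1 / 2) ^ length ?as"
      using a gauss_orbit_unit_interval[OF assms, of n] by (intro cf_eval_contracts) auto
    ultimately show ?thesis by (simp add: approximant_def cf_eval_0 del: upt_Suc)
  qed
  have "(\<lambda>n. 2 * (1 / 2) ^ n :: real) \<longlonglongrightarrow> 0" by real_asymp
  with always_eventually[OF allI[OF bound]]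
  have "(\<lambda>n. real_of_rat (approximant ?a n) - x) \<longlonglongrightarrow> 0"
    by (rule Lim_null_comparison)
  then have "is_cfrac ?a x"
    using a by (auto simp: is_cfrac_def LIM_zero_iff)
  then show ?thesis by (rule infinite)
qed

section \<open>Splitting off the first digit\<close>

lemma approximant_Suc:
  "real_of_rat (approximant a (Suc n)) =
     1 / (real (a 1) + real_of_rat (approximant (\<lambda>i. a (Suc i)) n))"
proof -
  have "[1..<Suc (Suc n)] = 1 # map Suc [1..<Suc n]"
    by (subst upt_conv_Cons) (simp_all add: map_Suc_upt del: upt_Suc)
  then show ?thesis
    by (simp add: approximant_def of_rat_divide of_rat_add comp_def del: upt_Suc)
qed

lemma approximant_unit_interval:
  assumes "\<forall>i\<ge>1. a i \<ge> 1"
  shows "real_of_rat (approximant a n) \<in> {0..1}"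
  unfolding approximant_def cf_eval_0[symmetric]
  using assms by (intro cf_eval_unit_interval) auto

text \<open>The approximants are at least \<open>1 / (a 1 + 1)\<close>, so their limit is not 0 and the first digit can be
  removed by inverting.\<close>

lemma is_cfrac_tail:
  assumes "is_cfrac a x"
  obtains y where "is_cfrac (\<lambda>i. a (Suc i)) y" "y \<in> {0..1}" "x = 1 / (real (a 1) + y)"
proof -
  let ?r = "\<lambda>n. real_of_rat (approximant a n)"
    and ?r' = "\<lambda>n. real_of_rat (approximant (\<lambda>i. a (Suc i)) n)"
  have a: "\<forall>i\<ge>1. a i \<ge> 1" and lim: "?r \<longlonglongrightarrow> x" using assms by (auto simp: is_cfrac_def)
  have r': "?r' n \<in> {0..1}" for n using a by (intro approximant_unit_interval) auto
  have lim: "(\<lambda>n. ?r (Suc n)) \<longlonglongrightarrow> x" using lim by (rule LIMSEQ_Suc)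
  have eq: "?r (Suc n) = 1 / (real (a 1) + ?r' n)" for n by (rule approximant_Suc)
  have a1: "1 \<le> real (a 1)" using a by auto
  have "1 / (real (a 1) + 1) \<le> x"
  proof (rule LIMSEQ_le_const[OF lim], intro exI allI impI)
    fix n show "1 / (real (a 1) + 1) \<le> ?r (Suc n)"
      unfolding eq using r'[of n] a1 unfolding atLeastAtMost_iff
      by (intro divide_left_mono mult_pos_pos) linarith+
  qed
  then have x: "x > 0" by (rule less_le_trans[rotated]) simp
  define y where "y = 1 / x - real (a 1)"
  have "(\<lambda>n. 1 / ?r (Suc n) - real (a 1)) \<longlonglongrightarrow> y"
    unfolding y_def using x by (intro tendsto_intros lim) auto
  then have y: "?r' \<longlonglongrightarrow> y" by (simp add: eq)
  have "y \<in> {0..1}"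
    using closed_sequentially[OF closed_atLeastAtMost _ y] r' by blast
  moreover have "is_cfrac (\<lambda>i. a (Suc i)) y" using a y by (simp add: is_cfrac_def)
  moreover have "x = 1 / (real (a 1) + y)" by (simp add: y_def)
  ultimately show ?thesis using that by blast
qed

lemma is_cfrac_prepend:
  assumes "c \<ge> 1" "is_cfrac b y" "y \<in> {0..1}"
  shows "is_cfrac (\<lambda>i. if i \<le> 1 then c else b (i - 1)) (1 / (real c + y))"
proof -
  let ?a = "\<lambda>i. if i \<le> 1 then c else b (i - 1)"
  have tail: "approximant (\<lambda>i. ?a (Suc i)) n = approximant b n" for n
    unfolding approximant_def by (intro arg_cong[of _ _ cfrac] map_cong) auto
  have "(\<lambda>n. 1 / (real c + real_of_rat (approximant b n))) \<longlonglongrightarrow> 1 / (real c + y)"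
    using assms by (intro tendsto_intros) (auto simp: is_cfrac_def)
  then have "(\<lambda>n. real_of_rat (approximant ?a (Suc n))) \<longlonglongrightarrow> 1 / (real c + y)"
    unfolding approximant_Suc tail by simp
  then have "(\<lambda>n. real_of_rat (approximant ?a n)) \<longlonglongrightarrow> 1 / (real c + y)"
    by (rule LIMSEQ_imp_Suc)
  then show ?thesis using assms by (auto simp: is_cfrac_def)
qed

lemma sum_1_Suc: "(\<Sum>i=1..Suc k. a i) = a 1 + (\<Sum>i=1..k. a (Suc i))" for a :: "nat \<Rightarrow> nat"
proof -
  have "(\<Sum>i=1..Suc k. a i) = a 1 + (\<Sum>i=Suc 1..Suc k. a i)"
    by (rule sum.atLeast_Suc_atMost) simp
  then show ?thesis by (simp only: sum.shift_bounds_cl_Suc_ivl)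
qed

lemma sum_level_set_infinite:
  assumes "is_cfrac a x" "x \<in> {0..1}" "k \<ge> 1" "(\<Sum>i=1..k. a i) = n"
  shows "x \<in> sum_level_set n"
  using assms unfolding sum_level_set_def by blast

lemma sum_level_set_finite:
  assumes "\<forall>a\<in>set as. a \<ge> 1" "x = real_of_rat (cfrac as)" "x \<in> {0..1}"
    "k \<in> {1..length as}" "sum_list (take k as) = n"
  shows "x \<in> sum_level_set n"
  using assms unfolding sum_level_set_def by blast

text \<open>The recursive description of the sum-level sets, free of limits and digit sequences. In the case
  \<open>c = n\<close> the remainder \<open>y\<close> is arbitrary because every number in \<open>[0, 1]\<close> has some expansion; finite
  and infinite expansions are treated alike from here on.\<close>

lemma sum_level_set_first_digit:
  assumes "n \<ge> 1"
  shows "x \<in> sum_level_set n \<longleftrightarrow>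
     (\<exists>c\<ge>1. \<exists>y\<in>{0..1}. x = 1 / (real c + y) \<and> (c = n \<or> c < n \<and> y \<in> sum_level_set (n - c)))"
    (is "_ \<longleftrightarrow> ?R")
proof
  assume "x \<in> sum_level_set n"
  then consider
    (infinite) a k where "is_cfrac a x" "k \<ge> 1" "(\<Sum>i=1..k. a i) = n"
  | (finite) as k where "\<forall>a\<in>set as. a \<ge> 1" "x = real_of_rat (cfrac as)"
      "k \<in> {1..length as}" "sum_list (take k as) = n"
    unfolding sum_level_set_def by blast
  then show ?R
  proof cases
    case infinite
    let ?b = "\<lambda>i. a (Suc i)"
    from infinite obtain y where y: "is_cfrac ?b y" "y \<in> {0..1}" "x = 1 / (real (a 1) + y)"
      by (metis is_cfrac_tail)
    have pos: "a i \<ge> 1" if "i \<ge> 1" for i using infinite that by (auto simp: is_cfrac_def)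
    obtain k' where k: "k = Suc k'" using infinite by (cases k) auto
    have sum: "n = a 1 + (\<Sum>i=1..k'. ?b i)" using infinite k sum_1_Suc by metis
    have "a 1 = n \<or> a 1 < n \<and> y \<in> sum_level_set (n - a 1)"
    proof (cases "k' = 0")
      case False
      then have "1 \<le> (\<Sum>i=1..k'. ?b i)"
        using member_le_sum[of 1 "{1..k'}" ?b] pos[of "Suc 1"] by auto
      then have "a 1 < n" using sum by simp
      moreover have "y \<in> sum_level_set (n - a 1)"
        using y False sum by (intro sum_level_set_infinite[of ?b _ k']) auto
      ultimately show ?thesis by blast
    qed (use sum in simp)
    then show ?thesis using y pos by blast
  next
    case finite
    then obtain c cs where as: "as = c # cs" by (cases as) auto
    let ?y = "real_of_rat (cfrac cs)"
    obtain k' where k: "k = Suc k'" using finite by (cases k) auto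
    have y: "?y \<in> {0..1}"
      unfolding cf_eval_0[symmetric] using finite as by (intro cf_eval_unit_interval) auto
    have x: "x = 1 / (real c + ?y)" using finite as by (simp add: of_rat_divide of_rat_add)
    have sum: "n = c + sum_list (take k' cs)" using finite as k by simp
    have "c = n \<or> c < n \<and> ?y \<in> sum_level_set (n - c)"
    proof (cases "k' = 0")
      case False
      then obtain d ds where "cs = d # ds" using finite as k by (cases cs) auto
      then have "1 \<le> sum_list (take k' cs)" using False finite as by (cases k') auto
      then have "c < n" using sum by simp
      moreover have "?y \<in> sum_level_set (n - c)"
        using y False sum finite as k by (intro sum_level_set_finite[of cs _ k']) auto
      ultimately show ?thesis by blast
    qed (use sum in simp)
    then show ?thesis using y x finite as by auto
  qed
next
  assume ?R
  then obtain c y where c: "c \<ge> 1" and y: "y \<in> {0..1}" and x: "x = 1 / (real c + y)"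
    and n: "c = n \<or> c < n \<and> y \<in> sum_level_set (n - c)" by blast
  have "1 \<le> real c + y" using c y by auto
  then have x01: "x \<in> {0..1}" unfolding x by auto
  have prepend_infinite: "x \<in> sum_level_set n"
    if "is_cfrac b y" "c + (\<Sum>i=1..k. b i) = n" for b k
  proof -
    let ?a = "\<lambda>i. if i \<le> 1 then c else b (i - 1)"
    have "(\<Sum>i=1..k. ?a (Suc i)) = (\<Sum>i=1..k. b i)" by (rule sum.cong) auto
    then have "(\<Sum>i=1..Suc k. ?a i) = n"
      unfolding sum_1_Suc using that(2) by simp
    then show ?thesis
      using is_cfrac_prepend[OF c that(1) y] x01 unfolding x
      by (intro sum_level_set_infinite[of ?a _ "Suc k"]) auto
  qed
  have prepend_finite: "x \<in> sum_level_set n"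
    if "\<forall>a\<in>set as. a \<ge> 1" "y = real_of_rat (cfrac as)" "k \<le> length as"
      "c + sum_list (take k as) = n" for as k
  proof (rule sum_level_set_finite[of "c # as" _ "Suc k"])
    show "x = real_of_rat (cfrac (c # as))" by (simp add: x that(2) of_rat_divide of_rat_add)
  qed (use that c x01 in auto)
  from n show "x \<in> sum_level_set n"
  proof
    assume "c = n"
    show ?thesis using y
    proof (cases rule: continued_fraction_exists)
      case (infinite b)
      then show ?thesis using prepend_infinite[of b 0] \<open>c = n\<close> by simp
    next
      case (finite as)
      then show ?thesis using prepend_finite[of as 0] \<open>c = n\<close> by simp
    qed
  next
    assume *: "c < n \<and> y \<in> sum_level_set (n - c)"
    then consider
      (infinite) b k where "is_cfrac b y" "(\<Sum>i=1..k. b i) = n - c"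
    | (finite) as k where "\<forall>a\<in>set as. a \<ge> 1" "y = real_of_rat (cfrac as)"
        "k \<in> {1..length as}" "sum_list (take k as) = n - c"
      unfolding sum_level_set_def by blast
    then show ?thesis
    proof cases
      case infinite
      then show ?thesis using prepend_infinite[of b k] * by simp
    next
      case finite
      then show ?thesis using prepend_finite[of as k] * by simp
    qed
  qed
qed

section \<open>Sum-level sets and the Farey map\<close>

lemma sum_level_set_1: "sum_level_set 1 = {1 / 2..1}"
proof (intro set_eqI iffI)
  fix x assume "x \<in> sum_level_set 1"
  then obtain y where y: "y \<in> {0..1}" and x: "x = 1 / (1 + y)"
    by (subst (asm) sum_level_set_first_digit) auto
  have "1 / 2 \<le> x" unfolding x using y by (intro frac_le) auto
  moreover have "x \<le> 1" unfolding x using y by auto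
  ultimately show "x \<in> {1 / 2..1}" by simp
next
  fix x :: real assume x: "x \<in> {1 / 2..1}"
  then have "1 / x - 1 \<in> {0..1}" "x = 1 / (real 1 + (1 / x - 1))" by (auto simp: field_simps)
  then show "x \<in> sum_level_set 1"
    by (subst sum_level_set_first_digit) (use le_refl in blast)+
qed

text \<open>The two inverse branches of the Farey map. On continued fractions the left one increases the first
  digit by 1 and the right one prepends the digit 1, so that both increase every digit sum by 1.\<close>

definition farey_left :: "real \<Rightarrow> real" where
  "farey_left y = y / (1 + y)"

definition farey_right :: "real \<Rightarrow> real" where
  "farey_right y = 1 / (1 + y)"

lemma sum_level_set_Suc:
  assumes "n \<ge> 1"
  shows "sum_level_set (Suc n) = farey_left ` sum_level_set n \<union> farey_right ` sum_level_set n"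
proof (intro set_eqI iffI)
  fix x assume "x \<in> sum_level_set (Suc n)"
  moreover have "Suc n \<ge> 1" by simp
  ultimately obtain c y where c: "c \<ge> 1" and y: "y \<in> {0..1}" and x: "x = 1 / (real c + y)"
    and n: "c = Suc n \<or> c < Suc n \<and> y \<in> sum_level_set (Suc n - c)"
    using sum_level_set_first_digit[of "Suc n" x] by blast
  show "x \<in> farey_left ` sum_level_set n \<union> farey_right ` sum_level_set n"
  proof (cases "c = 1")
    case True
    then show ?thesis using n assms x by (auto simp: farey_right_def)
  next
    case False
    then obtain d where d: "c = Suc d" "d \<ge> 1" using c by (cases c) auto
    have "1 / (real d + y) \<in> sum_level_set n"
      using d y n by (subst sum_level_set_first_digit[OF assms]) auto
    moreover have "x = farey_left (1 / (real d + y))"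
      using d y x by (simp add: farey_left_def divide_simps) (simp add: algebra_simps)
    ultimately show ?thesis by blast
  qed
next
  fix x assume "x \<in> farey_left ` sum_level_set n \<union> farey_right ` sum_level_set n"
  then show "x \<in> sum_level_set (Suc n)"
  proof
    assume "x \<in> farey_left ` sum_level_set n"
    then obtain z where z: "z \<in> sum_level_set n" "x = farey_left z" by blast
    then obtain c y where c: "c \<ge> 1" and y: "y \<in> {0..1}" and z': "z = 1 / (real c + y)"
      and n: "c = n \<or> c < n \<and> y \<in> sum_level_set (n - c)"
      using iffD1[OF sum_level_set_first_digit[OF assms]] by blast
    have "x = 1 / (real (Suc c) + y)"
      using c y z z' by (simp add: farey_left_def divide_simps) (simp add: algebra_simps)
    then show ?thesis
      using c y n by (subst sum_level_set_first_digit) (auto intro!: exI[of _ "Suc c"])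
  next
    assume "x \<in> farey_right ` sum_level_set n"
    then obtain y where y: "y \<in> sum_level_set n" "x = farey_right y" by blast
    have "y \<in> {0..1}" using y by (simp add: sum_level_set_def)
    then show ?thesis
      using y assms by (subst sum_level_set_first_digit) (auto simp: farey_right_def intro!: exI[of _ 1])
  qed
qed

text \<open>The ranges of the two branches meet only in \<open>1 / 2\<close>, which both take at 1.\<close>

lemma farey_inj:
  assumes "x \<in> {0..1}" "y \<in> {0..1}"
  shows "farey_left x = farey_left y \<longleftrightarrow> x = y" "farey_right x = farey_right y \<longleftrightarrow> x = y"
    "farey_left x = farey_right y \<longleftrightarrow> x = 1 \<and> y = 1"
proof -
  show "farey_left x = farey_left y \<longleftrightarrow> x = y" "farey_right x = farey_right y \<longleftrightarrow> x = y"
    using assms by (auto simp: farey_left_def farey_right_def divide_simps algebra_simps)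
  have "x * (1 + y) = 1 + x \<longleftrightarrow> x * y = 1" by (auto simp: algebra_simps)
  moreover have "x * y = 1 \<longleftrightarrow> x = 1 \<and> y = 1"
    using assms mult_mono[of x 1 y 1] mult_left_le[of y x] mult_left_le_one_le[of y x] by auto
  ultimately show "farey_left x = farey_right y \<longleftrightarrow> x = 1 \<and> y = 1"
    using assms by (auto simp: farey_left_def farey_right_def divide_simps)
qed

text \<open>The point \<open>1 / 2\<close> causes no trouble, as it has the same preimage under both branches.\<close>

lemma farey_sum_level_set_iff:
  assumes "n \<ge> 1" "x \<in> {0..1}"
  shows "farey_left x \<in> sum_level_set (Suc n) \<longleftrightarrow> x \<in> sum_level_set n"
    and "farey_right x \<in> sum_level_set (Suc n) \<longleftrightarrow> x \<in> sum_level_set n"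
proof -
  have "sum_level_set n \<subseteq> {0..1}" by (auto simp: sum_level_set_def)
  then have inj: "farey_left x = farey_left y \<longleftrightarrow> x = y" "farey_right x = farey_right y \<longleftrightarrow> x = y"
    "farey_left x = farey_right y \<longleftrightarrow> x = 1 \<and> y = 1" "farey_right x = farey_left y \<longleftrightarrow> x = 1 \<and> y = 1"
    if "y \<in> sum_level_set n" for y
    using farey_inj[OF assms(2), of y] farey_inj(3)[of y x] assms(2) that by fastforce+
  show "farey_left x \<in> sum_level_set (Suc n) \<longleftrightarrow> x \<in> sum_level_set n"
    and "farey_right x \<in> sum_level_set (Suc n) \<longleftrightarrow> x \<in> sum_level_set n"
    unfolding sum_level_set_Suc[OF assms(1)] using inj by (fastforce simp: image_iff)+
qed

lemma farey_left_le_iff: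
  assumes "0 \<le> x" "0 \<le> y"
  shows "farey_left x \<le> farey_left y \<longleftrightarrow> x \<le> y"
  using assms by (simp add: farey_left_def divide_simps add_pos_nonneg) (simp add: algebra_simps)

text \<open>The left branch has the inverse \<open>x \<mapsto> x / (1 - x)\<close>.\<close>

lemma farey_left_image:
  assumes "0 \<le> a" "a \<le> b"
  shows "farey_left ` {a..b} = {farey_left a..farey_left b}"
proof (intro equalityI subsetI)
  fix x assume "x \<in> farey_left ` {a..b}"
  then show "x \<in> {farey_left a..farey_left b}" using assms by (auto simp: farey_left_le_iff)
next
  fix x assume x: "x \<in> {farey_left a..farey_left b}"
  define y where "y = x / (1 - x)"
  have "farey_left b < 1" "farey_left a \<ge> 0" using assms by (auto simp: farey_left_def divide_simps)
  then have x01: "0 \<le> x" "x < 1" using x by auto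
  have "farey_left y = x"
    using x01 by (simp add: farey_left_def y_def divide_simps)
  moreover from this have "y \<in> {a..b}"
    using x x01 assms farey_left_le_iff[of a y] farey_left_le_iff[of y b] by (auto simp: y_def)
  ultimately show "x \<in> farey_left ` {a..b}" by blast
qed

lemma farey_right_image:
  assumes "0 \<le> a" "a \<le> b"
  shows "farey_right ` {a..b} = {farey_right b..farey_right a}"
proof -
  \<comment> \<open>The right branch is the left one followed by the reflection \<open>x \<mapsto> 1 - x\<close>.\<close>
  have reflect: "farey_right y = 1 - farey_left y" if "0 \<le> y" for y
    using that by (simp add: farey_left_def farey_right_def divide_simps)
  have "farey_right ` {a..b} = (\<lambda>x. 1 - x) ` farey_left ` {a..b}"
    unfolding image_image using assms by (intro image_cong) (auto simp: reflect)
  then show ?thesis using assms by (simp add: farey_left_image reflect)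
qed

section \<open>Stern--Brocot intervals and the Farey map\<close>

text \<open>The recursion with indices counted from 0, stated with successors so that it can be unfolded one
  order at a time.\<close>

lemma sb_recursion:
  "sb_s (Suc n) (Suc (2 * k)) = sb_s n (Suc k)"
  "sb_s (Suc n) (Suc (Suc (2 * k))) = sb_s n (Suc k) + sb_s n (Suc (Suc k))"
  "sb_t (Suc n) (Suc (2 * k)) = sb_t n (Suc k)"
  "sb_t (Suc n) (Suc (Suc (2 * k))) = sb_t n (Suc k) + sb_t n (Suc (Suc k))"
  by simp_all

text \<open>Besides the insertion of mediants, order \<open>n + 1\<close> arises from order \<open>n\<close> through the Farey branches: the
  left half by \<open>s / t \<mapsto> s / (s + t)\<close>, and the right half, in reversed order, by
  \<open>s / t \<mapsto> t / (s + t)\<close>. Taking mediants commutes with both.\<close>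

lemma sb_farey_left:
  "k \<le> 2 ^ n \<Longrightarrow> sb_s (Suc n) (Suc k) = sb_s n (Suc k) \<and>
     sb_t (Suc n) (Suc k) = sb_s n (Suc k) + sb_t n (Suc k)"
proof (induction n arbitrary: k)
  case 0
  then have "k = 0 \<or> k = 1" by auto
  then show ?case by auto
next
  case (Suc n)
  show ?case
  proof (cases "odd k")
    case True
    then obtain j where k: "k = Suc (2 * j)" by (auto elim: oddE)
    show ?thesis unfolding k sb_recursion[of "Suc n"] sb_recursion[of n]
      using Suc.IH[of j] Suc.IH[of "Suc j"] Suc.prems by (simp add: k del: sb_s.simps sb_t.simps)
  next
    case False
    then obtain j where k: "k = 2 * j" by (auto elim: evenE)
    show ?thesis unfolding k sb_recursion[of "Suc n"] sb_recursion[of n]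
      using Suc.IH[of j] Suc.prems by (simp add: k del: sb_s.simps sb_t.simps)
  qed
qed

lemma sb_farey_right:
  "k \<le> 2 ^ n \<Longrightarrow> k + l = 2 ^ Suc n \<Longrightarrow> sb_s (Suc n) (Suc l) = sb_t n (Suc k) \<and>
     sb_t (Suc n) (Suc l) = sb_s n (Suc k) + sb_t n (Suc k)"
proof (induction n arbitrary: k l)
  case 0
  then have "k = 0 \<and> l = 2 \<or> k = 1 \<and> l = 1" by auto
  then show ?case by auto
next
  case (Suc n)
  have "even (k + l)" using Suc.prems by simp
  show ?case
  proof (cases "odd k")
    case True
    then obtain i j where k: "k = Suc (2 * j)" and l: "l = Suc (2 * i)"
      using \<open>even (k + l)\<close> by (auto elim!: oddE)
    show ?thesis unfolding k l sb_recursion[of "Suc n"] sb_recursion[of n]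
      using Suc.IH[of j "Suc i"] Suc.IH[of "Suc j" i] Suc.prems
      by (simp add: k l del: sb_s.simps sb_t.simps)
  next
    case False
    then obtain i j where k: "k = 2 * j" and l: "l = 2 * i"
      using \<open>even (k + l)\<close> by (auto elim!: evenE)
    show ?thesis unfolding k l sb_recursion[of "Suc n"] sb_recursion[of n]
      using Suc.IH[of j i] Suc.prems by (simp add: k l del: sb_s.simps sb_t.simps)
  qed
qed

definition sb_frac :: "nat \<Rightarrow> nat \<Rightarrow> real" where
  "sb_frac n k = real (sb_s n (Suc k)) / real (sb_t n (Suc k))"

definition sb_interval :: "nat \<Rightarrow> nat \<Rightarrow> real set" where
  "sb_interval n k = {sb_frac n k..sb_frac n (Suc k)}"

lemma sb_intervals_eq: "sb_intervals n = sb_interval n ` {..<2 ^ n}"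
proof -
  have "{1..2 ^ n} = Suc ` {..<2 ^ n :: nat}"
    by (simp add: lessThan_atLeast0 atLeastLessThanSuc_atLeastAtMost)
  then show ?thesis
    unfolding sb_intervals_def sb_interval_def sb_frac_def Setcompr_eq_image by (simp add: image_image)
qed

lemma sb_frac_Suc:
  assumes "k < 2 ^ n"
  shows "sb_frac n (Suc k) = sb_frac n k + 1 / (real (sb_t n (k + 1)) * real (sb_t n (k + 2)))"
proof -
  have "real (sb_s n (k + 2) * sb_t n (k + 1)) = real (sb_s n (k + 1) * sb_t n (k + 2) + 1)"
    by (subst sb_determinant[OF assms]) simp
  then show ?thesis
    using sb_t_pos[of n "k + 1"] sb_t_pos[of n "k + 2"] by (simp add: sb_frac_def field_simps)
qed

lemma sb_frac_mono_Suc: "k < 2 ^ n \<Longrightarrow> sb_frac n k < sb_frac n (Suc k)"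
  using sb_t_pos[of n "k + 1"] sb_t_pos[of n "k + 2"] by (simp add: sb_frac_Suc)

lemma sb_frac_less: "i < j \<Longrightarrow> j \<le> 2 ^ n \<Longrightarrow> sb_frac n i < sb_frac n j"
proof (induction j)
  case (Suc j)
  then show ?case using sb_frac_mono_Suc[of j n] by (cases "i = j") auto
qed simp

lemma inj_on_sb_interval: "inj_on (sb_interval n) {..<2 ^ n}"
proof (rule inj_onI)
  fix i j :: nat assume *: "i \<in> {..<2 ^ n}" "j \<in> {..<2 ^ n}" "sb_interval n i = sb_interval n j"
  then have "sb_frac n i = sb_frac n j"
    using sb_frac_mono_Suc[of i n] sb_frac_mono_Suc[of j n] by (auto simp: sb_interval_def Icc_eq_Icc)
  then show "i = j"
    using sb_frac_less[of i j n] sb_frac_less[of j i n] * by (cases i j rule: linorder_cases) auto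
qed

lemma diameter_sb_interval:
  "k < 2 ^ n \<Longrightarrow> diameter (sb_interval n k) = 1 / (real (sb_t n (k + 1)) * real (sb_t n (k + 2)))"
  using sb_frac_mono_Suc[of k n] by (simp add: sb_interval_def sb_frac_Suc)


lemma sb_frac_unit_interval: "sb_frac n k \<in> {0..1}"
proof -
  have "sb_s n k \<le> sb_t n k" for k
    by (induction n arbitrary: k) (auto intro: add_mono)
  then show ?thesis using sb_t_pos[of n "Suc k"] by (simp add: sb_frac_def)
qed

lemma sb_interval_unit_interval: "sb_interval n k \<subseteq> {0..1}"
  using sb_frac_unit_interval[of n k] sb_frac_unit_interval[of n "Suc k"]
  by (auto simp: sb_interval_def)

text \<open>The reflection \<open>k \<mapsto> 2 ^ Suc n - k\<close> comes from the right branch being decreasing.\<close>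

lemma sb_frac_farey:
  assumes "k \<le> 2 ^ n"
  shows "sb_frac (Suc n) k = farey_left (sb_frac n k)"
    and "sb_frac (Suc n) (2 ^ Suc n - k) = farey_right (sb_frac n k)"
proof -
  have "real (sb_t n (Suc k)) > 0" using sb_t_pos by simp
  moreover have "sb_s (Suc n) (Suc (2 ^ Suc n - k)) = sb_t n (Suc k) \<and>
    sb_t (Suc n) (Suc (2 ^ Suc n - k)) = sb_s n (Suc k) + sb_t n (Suc k)"
    using assms by (intro sb_farey_right) auto
  ultimately show "sb_frac (Suc n) k = farey_left (sb_frac n k)"
    and "sb_frac (Suc n) (2 ^ Suc n - k) = farey_right (sb_frac n k)"
    using sb_farey_left[OF assms]
    by (simp_all add: sb_frac_def farey_left_def farey_right_def divide_simps add_nonneg_pos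
        add_pos_nonneg less_imp_neq[symmetric] del: sb_s.simps sb_t.simps)
qed

lemma sb_interval_farey:
  assumes "k < 2 ^ n"
  shows "sb_interval (Suc n) k = farey_left ` sb_interval n k"
    and "sb_interval (Suc n) (2 ^ Suc n - Suc k) = farey_right ` sb_interval n k"
proof -
  have "0 \<le> sb_frac n k" "sb_frac n k \<le> sb_frac n (Suc k)"
    using sb_frac_unit_interval[of n k] sb_frac_mono_Suc[OF assms] by auto
  moreover have "Suc (2 ^ Suc n - Suc k) = 2 ^ Suc n - k" using assms by simp
  ultimately show "sb_interval (Suc n) k = farey_left ` sb_interval n k"
    and "sb_interval (Suc n) (2 ^ Suc n - Suc k) = farey_right ` sb_interval n k"
    unfolding sb_interval_def using assms sb_frac_farey[of k n] sb_frac_farey[of "Suc k" n]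
    by (simp_all only: farey_left_image farey_right_image less_imp_le Suc_leI)
qed

text \<open>By induction along the Farey branches. The left branch keeps the index \<open>k\<close>, and the right branch turns
  it into \<open>2 ^ Suc n - 1 - k\<close>, which is \<open>3 - k\<close> modulo 4; both preserve the set of residues \<open>{1, 2}\<close>.\<close>

lemma sb_interval_level_iff:
  assumes "n \<ge> 1" "k < 2 ^ n"
  shows "sb_interval n k \<subseteq> sum_level_set n \<longleftrightarrow> k mod 4 \<in> {1, 2}"
  using assms
proof (induction n arbitrary: k rule: nat_induct_at_least)
  case base
  then have "k = 0 \<or> k = 1" by auto
  moreover have "sb_interval 1 0 = {0..1 / 2}" "sb_interval 1 1 = {1 / 2..1}"
    by (simp_all add: sb_interval_def sb_frac_def)
  ultimately show ?case unfolding sum_level_set_1 by auto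
next
  case (Suc n)
  have iff: "farey_left ` sb_interval n j \<subseteq> sum_level_set (Suc n) \<longleftrightarrow> sb_interval n j \<subseteq> sum_level_set n"
    "farey_right ` sb_interval n j \<subseteq> sum_level_set (Suc n) \<longleftrightarrow> sb_interval n j \<subseteq> sum_level_set n" for j
    using farey_sum_level_set_iff[OF Suc.hyps] sb_interval_unit_interval[of n j] by blast+
  show ?case
  proof (cases "k < 2 ^ n")
    case True
    then show ?thesis using Suc.IH[of k] by (simp only: sb_interval_farey iff)
  next
    case False
    define j where "j = 2 ^ Suc n - Suc k"
    have j: "j < 2 ^ n" "2 ^ Suc n - Suc j = k" using Suc.prems False by (auto simp: j_def)
    have "4 dvd (2 ^ Suc n :: nat)"
      using le_imp_power_dvd[of 2 "Suc n" "2 :: nat"] Suc.hyps by simp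
    moreover have "j + Suc k = 2 ^ Suc n" using Suc.prems by (simp add: j_def)
    ultimately have "4 dvd j + Suc k" by metis
    then have "k mod 4 \<in> {1, 2} \<longleftrightarrow> j mod 4 \<in> {1, 2}" by (simp, presburger)
    then show ?thesis
      using Suc.IH[OF j(1)] sb_interval_farey(2)[OF j(1)] iff(2)[of j] unfolding j(2) by simp
  qed
qed

lemma sb_interval_level_colevel:
  assumes "n \<ge> 1" "k < 2 ^ n"
  shows "sb_interval n k \<in> level_intervals n \<longleftrightarrow> k mod 4 \<in> {1, 2}"
    and "sb_interval n k \<in> colevel_intervals n \<longleftrightarrow> k mod 4 \<notin> {1, 2}"
  using assms sb_interval_level_iff[OF assms]
  by (auto simp: level_intervals_def colevel_intervals_def sb_intervals_eq)

section \<open>Comparison of the partition sums\<close>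

lemma powr_le_of_ratio_bounded:
  fixes x y C :: real
  assumes "0 < x" "0 < y" "0 < C" "x \<le> C * y" "y \<le> C * x"
  shows "x powr t \<le> C powr \<bar>t\<bar> * y powr t"
proof (cases "t \<ge> 0")
  case True
  then show ?thesis using powr_mono2[of t x "C * y"] assms by (simp add: powr_mult)
next
  case False
  then have "(C * x) powr t \<le> y powr t" using assms by (intro powr_mono2') auto
  then have "x powr t \<le> y powr t / C powr t"
    using assms by (simp add: powr_mult field_simps)
  then show ?thesis using False by (simp add: powr_minus_divide)
qed

text \<open>For end point denominators \<open>a\<close> and \<open>b\<close>, the diameter is \<open>1 / (a b)\<close>, and \<open>a b \<le> (a + b)\<^sup>2 \<le> C a b\<close>
  since the ratio of \<open>a\<close> and \<open>b\<close> is at most \<open>n + 1\<close> either way.\<close>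

lemma diameter_den_sum_comparable:
  fixes t :: real
  assumes "k < 2 ^ n"
  defines "C \<equiv> 2 * real n + 4" and "d \<equiv> diameter (sb_interval n k)"
  shows "real (den_sum n k) powr (- 2 * t) \<le> C powr \<bar>t\<bar> * d powr t"
    and "d powr t \<le> C powr \<bar>t\<bar> * real (den_sum n k) powr (- 2 * t)"
proof -
  define a b where "a = real (sb_t n (k + 1))" and "b = real (sb_t n (k + 2))"
  have pos: "a > 0" "b > 0" using sb_t_pos by (simp_all add: a_def b_def)
  have "sb_t n (k + 1) \<le> (n + 1) * sb_t n (k + 2)" "sb_t n (k + 2) \<le> (n + 1) * sb_t n (k + 1)"
    using sb_t_neighbours[of n "k + 1"] by simp_all
  from this[THEN of_nat_mono[where 'a = real]]
  have ratio: "a \<le> (real n + 1) * b" "b \<le> (real n + 1) * a"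
    by (simp_all add: a_def b_def algebra_simps)
  have d: "d = 1 / (a * b)" using diameter_sb_interval[OF assms(1)] by (simp add: d_def a_def b_def)
  define x where "x = 1 / (a + b)\<^sup>2"
  have "(a + b)\<^sup>2 = a * a + b * b + 2 * (a * b)" by (simp add: power2_eq_square algebra_simps)
  also have "\<dots> \<le> ((real n + 1) * b) * a + ((real n + 1) * a) * b + 2 * (a * b)"
    using ratio pos by (intro add_mono mult_right_mono) auto
  also have "\<dots> = C * (a * b)" by (simp add: C_def algebra_simps)
  finally have upper: "(a + b)\<^sup>2 \<le> C * (a * b)" .
  have lower: "a * b \<le> (a + b)\<^sup>2" using pos by (simp add: power2_eq_square algebra_simps)
  have "C \<ge> 1" by (simp add: C_def)
  have "x \<le> d" unfolding x_def d using lower pos by (intro divide_left_mono) auto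
  also have "d \<le> C * d" using mult_right_mono[of 1 C d] \<open>C \<ge> 1\<close> pos by (simp add: d)
  finally have 1: "x \<le> C * d" .
  have 2: "d \<le> C * x" unfolding x_def d using upper pos by (simp add: field_simps)
  have "x = (a + b) powr (- 2)" using pos by (simp add: x_def powr_minus_divide)
  then have "x powr t = (a + b) powr (- 2 * t)" by (simp only: powr_powr)
  also have "a + b = real (den_sum n k)" by (simp add: den_sum_def a_def b_def)
  finally have "x powr t = real (den_sum n k) powr (- 2 * t)" .
  moreover have "0 < x" "0 < d" using pos by (auto simp: x_def d)
  ultimately show "real (den_sum n k) powr (- 2 * t) \<le> C powr \<bar>t\<bar> * d powr t"
    "d powr t \<le> C powr \<bar>t\<bar> * real (den_sum n k) powr (- 2 * t)"
    using powr_le_of_ratio_bounded[of x d C t] powr_le_of_ratio_bounded[of d x C t] 1 2 \<open>C \<ge> 1\<close>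
    by auto
qed

text \<open>The two halves of an interval with end point denominators \<open>a\<close> and \<open>b\<close> have the denominator sums
  \<open>2 a + b\<close> and \<open>a + 2 b\<close>, which lie between \<open>a + b\<close> and its double.\<close>

lemma den_sum_child:
  assumes "c div 2 = k"
  shows "real (den_sum n k) powr (- 2 * t) \<le> 2 powr (2 * \<bar>t\<bar>) * real (den_sum (Suc n) c) powr (- 2 * t)"
proof -
  have "c = 2 * k \<or> c = Suc (2 * k)" using assms by auto
  then have "den_sum n k \<le> den_sum (Suc n) c" "den_sum (Suc n) c \<le> 2 * den_sum n k"
    by (auto simp: den_sum_def)
  then have "real (den_sum n k) \<le> 2 * real (den_sum (Suc n) c)"
    "real (den_sum (Suc n) c) \<le> 2 * real (den_sum n k)"
    by linarith+
  then have "real (den_sum n k) powr (- 2 * t) \<le>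
      2 powr \<bar>- 2 * t\<bar> * real (den_sum (Suc n) c) powr (- 2 * t)"
    using den_sum_ge_1[of n k] den_sum_ge_1[of "Suc n" c]
    by (intro powr_le_of_ratio_bounded) auto
  then show ?thesis by (simp add: abs_mult)
qed

lemma partition_upper:
  assumes "\<F> \<subseteq> sb_intervals n"
  shows "(\<Sum>I\<in>\<F>. diameter I powr t) \<le> (2 * real n + 4) powr \<bar>t\<bar> * den_partition t n"
proof -
  have "(\<Sum>I\<in>\<F>. diameter I powr t) \<le> (\<Sum>I\<in>sb_intervals n. diameter I powr t)"
    using assms by (intro sum_mono2) (auto simp: sb_intervals_eq)
  also have "\<dots> = (\<Sum>k<2 ^ n. diameter (sb_interval n k) powr t)"
    unfolding sb_intervals_eq by (subst sum.reindex[OF inj_on_sb_interval]) simp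
  also have "\<dots> \<le> (2 * real n + 4) powr \<bar>t\<bar> * den_partition t n"
    unfolding den_partition_def sum_distrib_left
    by (intro sum_mono diameter_den_sum_comparable) auto
  finally show ?thesis .
qed

text \<open>A family that contains one half, number \<open>c k\<close>, of every interval \<open>k\<close> of the preceding order has a
  partition sum of at least the size of that order's full sum, up to a polynomial factor. That
  factor is the constant \<open>C\<close> above for order \<open>n + 1\<close>, since \<open>2 (n + 1) + 4 = 2 n + 6\<close>, times the cost
  of passing from an interval to its half.\<close>

lemma partition_lower:
  assumes "\<F> \<subseteq> sb_intervals (Suc n)"
    and "\<And>k. c k div 2 = k" "\<And>k. k < 2 ^ n \<Longrightarrow> sb_interval (Suc n) (c k) \<in> \<F>"
  shows "den_partition t n \<le>
    2 powr (2 * \<bar>t\<bar>) * ((2 * real n + 6) powr \<bar>t\<bar> * (\<Sum>I\<in>\<F>. diameter I powr t))"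
proof -
  let ?K = "2 powr (2 * \<bar>t\<bar>)" and ?C = "(2 * real n + 6) powr \<bar>t\<bar>"
  have c: "c k < 2 ^ Suc n" if "k < 2 ^ n" for k using assms(2)[of k] that by simp
  have "inj_on c {..<2 ^ n}" by (rule inj_on_inverseI[of _ "\<lambda>k. k div 2"]) (rule assms(2))
  then have inj: "inj_on (\<lambda>k. sb_interval (Suc n) (c k)) {..<2 ^ n}"
    using c inj_on_sb_interval[of "Suc n"] by (auto simp: inj_on_def)
  have "den_partition t n \<le> (\<Sum>k<2 ^ n. ?K * (?C * diameter (sb_interval (Suc n) (c k)) powr t))"
    unfolding den_partition_def
  proof (rule sum_mono)
    fix k :: nat assume "k \<in> {..<2 ^ n}"
    then have "c k < 2 ^ Suc n" using c by simp
    from diameter_den_sum_comparable(1)[OF this, of t]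
    have "real (den_sum (Suc n) (c k)) powr (- 2 * t) \<le>
        ?C * diameter (sb_interval (Suc n) (c k)) powr t" by (simp add: algebra_simps)
    then show "real (den_sum n k) powr (- 2 * t) \<le>
        ?K * (?C * diameter (sb_interval (Suc n) (c k)) powr t)"
      using den_sum_child[OF assms(2), of n k t] by (smt (verit) mult_left_mono powr_ge_zero)
  qed
  also have "\<dots> = ?K * (?C * (\<Sum>I\<in>(\<lambda>k. sb_interval (Suc n) (c k)) ` {..<2 ^ n}. diameter I powr t))"
    by (simp add: sum.reindex[OF inj] sum_distrib_left)
  also have "\<dots> \<le> ?K * (?C * (\<Sum>I\<in>\<F>. diameter I powr t))"
    using assms finite_subset[OF assms(1)]
    by (intro mult_left_mono sum_mono2) (auto simp: sb_intervals_eq)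
  finally show ?thesis .
qed

text \<open>The common value of the three pressure functions.\<close>

definition sb_pressure :: "real \<Rightarrow> real" where
  "sb_pressure t = lim (\<lambda>n. ln (den_partition t n) / real n)"

lemma den_partition_rate_tendsto:
  "(\<lambda>n. ln (den_partition t n) / real n) \<longlonglongrightarrow> sb_pressure t"
  using den_partition_rate_convergent unfolding sb_pressure_def by (rule convergent_LIMSEQ_iff[THEN iffD1])

text \<open>Polynomial factors disappear in \<open>1 / n * ln\<close>, and so does the shift of the order by one in the lower
  bound.\<close>

lemma log_partition_tendsto:
  assumes "\<And>n. F n \<subseteq> sb_intervals n"
    and "\<And>k. c k div 2 = k" "\<And>n k. k < 2 ^ n \<Longrightarrow> sb_interval (Suc n) (c k) \<in> F (Suc n)"
  shows "log_partition F t \<longlonglongrightarrow> sb_pressure t"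
proof (rule LIMSEQ_imp_Suc, rule real_tendsto_sandwich)
  let ?W = "den_partition t" and ?Z = "\<lambda>n. \<Sum>I\<in>F n. diameter I powr t"
  let ?low = "\<lambda>n. ln (?W n) / real n * (real n / real (Suc n)) -
    \<bar>t\<bar> * ((2 * ln 2 + ln (2 * real n + 6)) / real (Suc n))"
  let ?up = "\<lambda>n. ln (?W (Suc n)) / real (Suc n) + \<bar>t\<bar> * (ln (2 * real n + 6) / real (Suc n))"
  have Z: "ln (?W n) \<le> 2 * \<bar>t\<bar> * ln 2 + \<bar>t\<bar> * ln (2 * real n + 6) + ln (?Z (Suc n))"
    "ln (?Z (Suc n)) \<le> \<bar>t\<bar> * ln (2 * real n + 6) + ln (?W (Suc n))" for n
  proof -
    have low: "?W n \<le> 2 powr (2 * \<bar>t\<bar>) * ((2 * real n + 6) powr \<bar>t\<bar> * ?Z (Suc n))"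
      by (rule partition_lower[of _ n c]) (use assms in auto)
    have up: "?Z (Suc n) \<le> (2 * real n + 6) powr \<bar>t\<bar> * ?W (Suc n)"
      using partition_upper[OF assms(1)[of "Suc n"], of t] by (simp add: algebra_simps)
    have "0 < ?Z (Suc n)"
      using order.strict_trans2[OF den_partition_pos low] by (simp add: zero_less_mult_iff)
    then show "ln (?W n) \<le> 2 * \<bar>t\<bar> * ln 2 + \<bar>t\<bar> * ln (2 * real n + 6) + ln (?Z (Suc n))"
      "ln (?Z (Suc n)) \<le> \<bar>t\<bar> * ln (2 * real n + 6) + ln (?W (Suc n))"
      using ln_mono[OF low den_partition_pos]
        ln_mono[OF up] den_partition_pos[of t "Suc n"]
      by (simp_all add: ln_mult_pos ln_powr algebra_simps)
  qed
  show "\<forall>\<^sub>F n in sequentially. ?low n \<le> log_partition F t (Suc n)"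
    using eventually_gt_at_top[of 0]
  proof eventually_elim
    case (elim n)
    then show ?case using Z(1)[of n]
      by (simp add: log_partition_def divide_simps del: of_nat_Suc) (simp add: algebra_simps)
  qed
  show "\<forall>\<^sub>F n in sequentially. log_partition F t (Suc n) \<le> ?up n"
    using Z(2) by (simp add: log_partition_def divide_simps del: of_nat_Suc) (simp add: algebra_simps)
  have lims: "(\<lambda>n. (2 * ln 2 + ln (2 * real n + 6)) / real (Suc n)) \<longlonglongrightarrow> 0"
    "(\<lambda>n. ln (2 * real n + 6) / real (Suc n)) \<longlonglongrightarrow> 0" "(\<lambda>n. real n / real (Suc n)) \<longlonglongrightarrow> 1"
    by real_asymp+
  note rate = den_partition_rate_tendsto[of t]
  have "?low \<longlonglongrightarrow> sb_pressure t * 1 - \<bar>t\<bar> * 0"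
    by (rule tendsto_diff[OF tendsto_mult[OF rate lims(3)] tendsto_mult_left[OF lims(1)]])
  moreover have "?up \<longlonglongrightarrow> sb_pressure t + \<bar>t\<bar> * 0"
    by (rule tendsto_add[OF LIMSEQ_Suc[OF rate] tendsto_mult_left[OF lims(2)]])
  ultimately show "?low \<longlonglongrightarrow> sb_pressure t" "?up \<longlonglongrightarrow> sb_pressure t" by simp_all
qed

text \<open>The halves of interval \<open>k\<close> are \<open>2 k\<close> and \<open>2 k + 1\<close>. Exactly one of them has a residue in \<open>{1, 2}\<close> modulo
  4, namely the right half for even \<open>k\<close> and the left half for odd \<open>k\<close>. Hence each of the level
  intervals and the colevel intervals contains exactly one half of every interval.\<close>

lemma log_partition_level_colevel_tendsto:
  assumes "F \<in> {sb_intervals, level_intervals, colevel_intervals}"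
  shows "log_partition F t \<longlonglongrightarrow> sb_pressure t"
proof -
  have sub: "F n \<subseteq> sb_intervals n" for n
    using assms by (auto simp: level_intervals_def colevel_intervals_def)
  define c where "c = (\<lambda>k::nat. if F = colevel_intervals \<longleftrightarrow> even k then 2 * k else Suc (2 * k))"
  have mod: "c k mod 4 \<in> {1, 2} \<longleftrightarrow> F \<noteq> colevel_intervals" for k
  proof -
    have "2 * k mod 4 \<in> {1, 2} \<longleftrightarrow> odd k" "Suc (2 * k) mod 4 \<in> {1, 2} \<longleftrightarrow> even k"
      unfolding insert_iff empty_iff by presburger+
    then show ?thesis
      unfolding c_def
      by (cases "F = colevel_intervals"; cases "even k"; simp only: if_True if_False simp_thms)
  qed
  have div: "c k div 2 = k" for k by (simp add: c_def)
  have "sb_interval (Suc n) (c k) \<in> F (Suc n)" if "k < 2 ^ n" for n k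
  proof -
    have c: "c k < 2 ^ Suc n" using that div[of k] by simp
    then show ?thesis
      using assms mod[of k] sb_interval_level_colevel[of "Suc n" "c k"]
      by (auto simp: sb_intervals_eq)
  qed
  with sub div show ?thesis by (rule log_partition_tendsto)
qed

theorem proposition6p1:
  shows "(\<forall>F \<in> {sb_intervals, level_intervals, colevel_intervals}. \<forall>t::real.
           log_partition F t \<longlonglongrightarrow> pressure F t) \<and>
         (\<forall>F \<in> {level_intervals, colevel_intervals}.
           (multifractal_formalism sb_intervals \<longrightarrow> multifractal_formalism F) \<and>
           (second_order_phase_transition sb_intervals \<longrightarrow> second_order_phase_transition F)) \<and>
         (\<forall>t::real. pressure sb_intervals t = pressure level_intervals t \<and>
           pressure sb_intervals t = pressure colevel_intervals t)"
proof -
  have *: "pressure F = sb_pressure" if "F \<in> {sb_intervals, level_intervals, colevel_intervals}" for F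
    unfolding pressure_def using log_partition_level_colevel_tendsto[OF that] by (auto intro: limI)
  then have "pressure sb_intervals = sb_pressure" "pressure level_intervals = sb_pressure"
    "pressure colevel_intervals = sb_pressure" by blast+
  then show ?thesis
    using log_partition_level_colevel_tendsto unfolding multifractal_formalism_def second_order_phase_transition_def
    by auto
qed

end
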